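(* Let $(V,\Omega)$ be a $6$-dimensional real symplectic vector space with symplectic basis $(e_1,e_2,e_3,f_1,f_2,f_3)$ and dual basis $(e_1^*,e_2^*,e_3^*,f_1^*,f_2^*,f_3^* )$. For a $3$-form $\omega$ on $V$ let $\mathcal{J}_\omega=\{X\in sp(V): L_X\omega=0\}$ be its stabilizer, the elements of $sp(V)$ being written as $6\times 6$ real matrices with respect to the basis $(e_1,e_2,e_3,f_1,f_2,f_3)$. The stabilizers of forms 1 to 5 of the list of normal forms of effective $3$-forms (recalled in the context) are: 1. $\omega=e_1^*\wedge e_2^*\wedge e_3^*+\gamma f_1^*\wedge f_2^*\wedge f_3^*$, $\gamma\neq 0$: $$\mathcal{J}_\omega=\left\{\begin{pmatrix}B&0\\0&-B^t\end{pmatrix}: B\in sl(3,\mathbb{R})\right\};$$ 2. $\omega=f_1^*\wedge e_2^*\wedge e_3^*+f_2^*\wedge e_1^*\wedge e_3^*+f_3^*\wedge e_1^*\wedge e_2^*+\nu^2f_1^*\wedge f_2^*\wedge f_3^*$, $\nu\neq0$: $$\mathcal{J}_\omega=\left\{\begin{pmatrix}0&\alpha&\beta&\lambda_1&\xi_1&\xi_2\\ \alpha&0&\gamma&\xi_1&\lambda_2&\xi_3\\ -\beta&\gamma&0&\xi_2&\xi_3&\lambda_3\\ -\nu^2\lambda_1&\nu^2\xi_1&-\nu^2\xi_2&0&-\alpha&\beta\\ \nu^2\xi_1&-\nu^2\lambda_2&\nu^2\xi_3&-\alpha&0&-\gamma\\ -\nu^2\xi_2&\nu^2\xi_3&-\nu^2\lambda_3&-\beta&-\gamma&0\end{pmatrix}: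 \lambda_1-\lambda_2+\lambda_3=0\right\};$$ 3. $\omega=f_1^*\wedge e_2^*\wedge e_3^*-f_2^*\wedge e_1^*\wedge e_3^*+f_3^*\wedge e_1^*\wedge e_2^*-\nu^2f_1^*\wedge f_2^*\wedge f_3^*$, $\nu\neq0$: $$\mathcal{J}_\omega=\left\{\begin{pmatrix}0&\alpha&\beta&\lambda_1&\xi_1&\xi_2\\ -\alpha&0&\gamma&\xi_1&\lambda_2&\xi_3\\ -\beta&-\gamma&0&\xi_2&\xi_3&\lambda_3\\ -\nu^2\lambda_1&-\nu^2\xi_1&-\nu^2\xi_2&0&\alpha&\beta\\ -\nu^2\xi_1&-\nu^2\lambda_2&-\nu^2\xi_3&-\alpha&0&\gamma\\ -\nu^2\xi_2&-\nu^2\xi_3&-\nu^2\lambda_3&-\beta&-\gamma&0\end{pmatrix}: \lambda_1+\lambda_2+\lambda_3=0\right\};$$ 4. $\omega=f_1^*\wedge e_2^*\wedge e_3^*+f_2^*\wedge e_1^*\wedge e_3^*+f_3^*\wedge e_1^*\wedge e_2^*$: $$\mathcal{J}_\omega=\left\{\begin{pmatrix}0&\alpha&\beta&\lambda_1&\xi_1&\xi_2\\ \alpha&0&\gamma&\xi_1&\lambda_2&\xi_3\\ -\beta&\gamma&0&\xi_2&\xi_3&\lambda_3\\ 0&0&0&0&-\alpha&\beta\\ 0&0&0&-\alpha&0&-\gamma\\ 0&0&0&-\beta&-\gamma&0\end{pmatrix}: \lambda_1-\lambda_2+\lambda_3=0\right\};$$ 5. $\omega=f_1^*\wedge e_2^*\wedge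 e_3^*+f_2^*\wedge e_1^*\wedge e_3^*-f_3^*\wedge e_1^*\wedge e_2^*$: $$\mathcal{J}_\omega=\left\{\begin{pmatrix}0&\alpha&\beta&\lambda_1&\xi_1&\xi_2\\ \alpha&0&\gamma&\xi_1&\lambda_2&\xi_3\\ \beta&-\gamma&0&\xi_2&\xi_3&\lambda_3\\ 0&0&0&0&-\alpha&-\beta\\ 0&0&0&-\alpha&0&\gamma\\ 0&0&0&-\beta&-\gamma&0\end{pmatrix}: \lambda_1-\lambda_2-\lambda_3=0\right\}.$$ In items 2 to 5 the parameters $\alpha,\beta,\gamma,\lambda_i,\xi_i$ range over $\mathbb{R}$, subject to the indicated relation.
   Context: A basis $(e_1,e_2,e_3,f_1,f_2,f_3)$ is symplectic if $\Omega=\sum_{i=1}^3e_i^*\wedge f_i^*$. A $3$-form $\omega$ on $V$ is effective if $\omega\wedge\Omega=0$. $sp(V)=sp(6)$ is the Lie algebra of the symplectic group $Sp(V)$; it acts on exterior forms by $X.\omega=L_X\omega$, where $X$ is regarded as a linear vector field on $V$ and $\omega$ as a differential form with constant coefficients, so that $L_X\omega=d(i_X\omega)$. Forms 1 to 5 in the list of normal forms of effective $3$-forms on $V$ under $Sp(6)$ are: (1) $e_1^*\wedge e_2^*\wedge e_3^*+\gamma f_1^*\wedge f_2^*\wedge f_3^*$, $\gamma\ne0$; (2) $f_1^*\wedge e_2^*\wedge e_3^*+f_2^*\wedge e_1^*\wedge e_3^*+f_3^*\wedge e_1^*\wedge e_2^*+\nu^2f_1^*\wedge f_2^*\wedge f_3^*$,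 $\nu\ne0$; (3) $f_1^*\wedge e_2^*\wedge e_3^*-f_2^*\wedge e_1^*\wedge e_3^*+f_3^*\wedge e_1^*\wedge e_2^*-\nu^2f_1^*\wedge f_2^*\wedge f_3^*$, $\nu\ne0$; (4) $f_1^*\wedge e_2^*\wedge e_3^*+f_2^*\wedge e_1^*\wedge e_3^*+f_3^*\wedge e_1^*\wedge e_2^*$; (5) $f_1^*\wedge e_2^*\wedge e_3^*-f_2^*\wedge e_1^*\wedge e_3^*+f_3^*\wedge e_1^*\wedge e_2^*$.
   Formalization: Matrices are read in the row convention: the i-th row lists the coordinates of X applied to the i-th basis vector (the transpose of the usual matrix of X); with the usual column convention items 2 to 5 are false as printed. *)

theory Defs
  imports "HOL-Analysis.Analysis"
begin

section \<open>Symplectic vector spaces\<close>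

definition symplectic_form :: "('v::real_vector \<Rightarrow> 'v \<Rightarrow> real) \<Rightarrow> bool" where
  "symplectic_form \<Omega> \<longleftrightarrow>
     (\<forall>u. linear (\<Omega> u)) \<and> (\<forall>v. linear (\<lambda>u. \<Omega> u v)) \<and>
     (\<forall>u. \<Omega> u u = 0) \<and>
     (\<forall>u. (\<forall>v. \<Omega> u v = 0) \<longrightarrow> u = 0)"

text \<open>A basis \<open>(e\<^sub>1,e\<^sub>2,e\<^sub>3,f\<^sub>1,f\<^sub>2,f\<^sub>3)\<close> is the family \<open>case_sum e f\<close> indexed by \<open>3 + 3\<close>.
  In the numeral type \<open>3\<close> the three elements are \<open>1\<close>, \<open>2\<close> and \<open>3 = 0\<close>.\<close>

definition is_basis :: "(3 \<Rightarrow> 'v::real_vector) \<Rightarrow> (3 \<Rightarrow> 'v) \<Rightarrow> bool" where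
  "is_basis e f \<longleftrightarrow>
     inj (case_sum e f) \<and> independent (range (case_sum e f)) \<and>
     span (range (case_sum e f)) = UNIV"

definition dual_basis ::
  "(3 \<Rightarrow> 'v::real_vector) \<Rightarrow> (3 \<Rightarrow> 'v) \<Rightarrow> (3 \<Rightarrow> 'v \<Rightarrow> real) \<Rightarrow> (3 \<Rightarrow> 'v \<Rightarrow> real) \<Rightarrow> bool" where
  "dual_basis e f es fs \<longleftrightarrow>
     (\<forall>i. linear (es i)) \<and> (\<forall>i. linear (fs i)) \<and>
     (\<forall>i j. es i (e j) = (if i = j then 1 else 0)) \<and> (\<forall>i j. es i (f j) = 0) \<and>
     (\<forall>i j. fs i (f j) = (if i = j then 1 else 0)) \<and> (\<forall>i j. fs i (e j) = 0)"

definition wedge2 :: "('v \<Rightarrow> real) \<Rightarrow> ('v \<Rightarrow> real) \<Rightarrow> 'v \<Rightarrow> 'v \<Rightarrow> real" where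
  "wedge2 a b u v = a u * b v - a v * b u"

definition wedge3 ::
  "('v \<Rightarrow> real) \<Rightarrow> ('v \<Rightarrow> real) \<Rightarrow> ('v \<Rightarrow> real) \<Rightarrow> 'v \<Rightarrow> 'v \<Rightarrow> 'v \<Rightarrow> real" where
  "wedge3 a b c u v w =
     a u * (b v * c w - b w * c v) - a v * (b u * c w - b w * c u) + a w * (b u * c v - b v * c u)"

definition symplectic_basis ::
  "('v::real_vector \<Rightarrow> 'v \<Rightarrow> real) \<Rightarrow> (3 \<Rightarrow> 'v) \<Rightarrow> (3 \<Rightarrow> 'v) \<Rightarrow>
   (3 \<Rightarrow> 'v \<Rightarrow> real) \<Rightarrow> (3 \<Rightarrow> 'v \<Rightarrow> real) \<Rightarrow> bool" where
  "symplectic_basis \<Omega> e f es fs \<longleftrightarrow>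
     is_basis e f \<and> dual_basis e f es fs \<and>
     (\<forall>u v. \<Omega> u v = (\<Sum>i\<in>UNIV. wedge2 (es i) (fs i) u v))"

definition Sp :: "('v::real_vector \<Rightarrow> 'v \<Rightarrow> real) \<Rightarrow> ('v \<Rightarrow> 'v) set" where
  "Sp \<Omega> = {g. linear g \<and> bij g \<and> (\<forall>u v. \<Omega> (g u) (g v) = \<Omega> u v)}"

text \<open>The Lie algebra of a closed group \<open>G\<close> of linear automorphisms, as the tangent space at the
  identity: the velocities at \<open>0\<close> of curves in \<open>G\<close> through the identity.  The
  derivative is taken weakly, i.e. after applying linear functionals; in finite dimension this is
  the derivative in the space of endomorphisms, and no norm on \<open>V\<close> has to be chosen.\<close>

definition lie_algebra_of :: "('v::real_vector \<Rightarrow> 'v) set \<Rightarrow> ('v \<Rightarrow> 'v) set" where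
  "lie_algebra_of G =
     {X. linear X \<and>
         (\<exists>g :: real \<Rightarrow> 'v \<Rightarrow> 'v. (\<forall>t. g t \<in> G) \<and> g 0 = id \<and>
            (\<forall>v \<phi>. linear \<phi> \<longrightarrow> ((\<lambda>t. \<phi> (g t v)) has_real_derivative \<phi> (X v)) (at 0)))}"

definition sp :: "('v::real_vector \<Rightarrow> 'v \<Rightarrow> real) \<Rightarrow> ('v \<Rightarrow> 'v) set" where
  "sp \<Omega> = lie_algebra_of (Sp \<Omega>)"


section \<open>Differential forms on a vector space\<close>

text \<open>A differential \<open>k\<close>-form takes the base point as its first argument, followed by \<open>k\<close> tangent
  vectors; a form with constant coefficients ignores the base point.\<close>

definition dir_deriv :: "'v::real_vector \<Rightarrow> ('v \<Rightarrow> real) \<Rightarrow> 'v \<Rightarrow> real" where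
  "dir_deriv v h p = deriv (\<lambda>t. h (p + t *\<^sub>R v)) 0"

definition ext_d2 ::
  "('v::real_vector \<Rightarrow> 'v \<Rightarrow> 'v \<Rightarrow> real) \<Rightarrow> 'v \<Rightarrow> 'v \<Rightarrow> 'v \<Rightarrow> 'v \<Rightarrow> real" where
  "ext_d2 \<eta> p u v w =
     dir_deriv u (\<lambda>q. \<eta> q v w) p - dir_deriv v (\<lambda>q. \<eta> q u w) p + dir_deriv w (\<lambda>q. \<eta> q u v) p"

definition ext_d3 ::
  "('v::real_vector \<Rightarrow> 'v \<Rightarrow> 'v \<Rightarrow> 'v \<Rightarrow> real) \<Rightarrow> 'v \<Rightarrow> 'v \<Rightarrow> 'v \<Rightarrow> 'v \<Rightarrow> 'v \<Rightarrow> real" where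
  "ext_d3 \<omega> p u v w z =
     dir_deriv u (\<lambda>q. \<omega> q v w z) p - dir_deriv v (\<lambda>q. \<omega> q u w z) p
     + dir_deriv w (\<lambda>q. \<omega> q u v z) p - dir_deriv z (\<lambda>q. \<omega> q u v w) p"

definition interior_prod :: "('v \<Rightarrow> 'v) \<Rightarrow> ('v \<Rightarrow> 'v \<Rightarrow> 'b) \<Rightarrow> 'v \<Rightarrow> 'b" where
  "interior_prod X \<omega> p = \<omega> p (X p)"

text \<open>Cartan's formula; for \<open>\<omega>\<close> with constant coefficients the second summand vanishes and
  \<open>L\<^sub>X \<omega> = d (i\<^sub>X \<omega>)\<close>.\<close>

definition lie_derivative ::
  "('v::real_vector \<Rightarrow> 'v) \<Rightarrow> ('v \<Rightarrow> 'v \<Rightarrow> 'v \<Rightarrow> 'v \<Rightarrow> real) \<Rightarrow> 'v \<Rightarrow> 'v \<Rightarrow> 'v \<Rightarrow> 'v \<Rightarrow> real" where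
  "lie_derivative X \<omega> p u v w =
     ext_d2 (interior_prod X \<omega>) p u v w + interior_prod X (ext_d3 \<omega>) p u v w"

definition stabilizer ::
  "('v::real_vector \<Rightarrow> 'v \<Rightarrow> real) \<Rightarrow> ('v \<Rightarrow> 'v \<Rightarrow> 'v \<Rightarrow> real) \<Rightarrow> ('v \<Rightarrow> 'v) set" where
  "stabilizer \<Omega> \<omega> =
     {X \<in> sp \<Omega>. \<forall>p u v w. lie_derivative X (\<lambda>_. \<omega>) p u v w = 0}"


section \<open>Matrices\<close>

text \<open>Row convention: with \<open>b = (e\<^sub>1,e\<^sub>2,e\<^sub>3,f\<^sub>1,f\<^sub>2,f\<^sub>3)\<close>, the \<open>i\<close>-th row consists of the coordinates
  of \<open>X b\<^sub>i\<close>, i.e. \<open>X b\<^sub>i = (\<Sum>j. M\<^sub>i\<^sub>j b\<^sub>j)\<close>.  Equivalently, the \<open>j\<close>-th column consists of the coordinates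
  of \<open>L\<^sub>X b\<^sub>j\<^sup>*\<close> in the dual basis.  The convention matters: transposing exchanges the two
  off-diagonal blocks, which are not on an equal footing in the stabilizers.\<close>

definition matrix_wrt ::
  "(3 \<Rightarrow> 'v) \<Rightarrow> (3 \<Rightarrow> 'v) \<Rightarrow> (3 \<Rightarrow> 'v \<Rightarrow> real) \<Rightarrow> (3 \<Rightarrow> 'v \<Rightarrow> real) \<Rightarrow>
   ('v \<Rightarrow> 'v) \<Rightarrow> real^(3 + 3)^(3 + 3)" where
  "matrix_wrt e f es fs X = (\<chi> i j. case_sum es fs j (X (case_sum e f i)))"

definition block :: "real^3^3 \<Rightarrow> real^3^3 \<Rightarrow> real^3^3 \<Rightarrow> real^3^3 \<Rightarrow> real^(3 + 3)^(3 + 3)" where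
  "block A B C D =
     (\<chi> i j. case i of
        Inl a \<Rightarrow> (case j of Inl b \<Rightarrow> A $ a $ b | Inr b \<Rightarrow> B $ a $ b)
      | Inr a \<Rightarrow> (case j of Inl b \<Rightarrow> C $ a $ b | Inr b \<Rightarrow> D $ a $ b))"

definition mat3 ::
  "real \<Rightarrow> real \<Rightarrow> real \<Rightarrow> real \<Rightarrow> real \<Rightarrow> real \<Rightarrow> real \<Rightarrow> real \<Rightarrow> real \<Rightarrow> real^3^3" where
  "mat3 a b c d e f g h i = vector [vector [a, b, c], vector [d, e, f], vector [g, h, i]]"

definition sl3 :: "(real^3^3) set" where
  "sl3 = {B. trace B = 0}"

end

theory Submission
  imports Defs
begin

text \<open>A symplectic transvection \<open>v \<mapsto> v + c \<Omega>(u,v) u\<close> depends affinely on \<open>c\<close>, so composing a curve in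
  the symplectic group with the transvections of parameter \<open>t c\<close> adds \<open>c \<Omega>(u,\<cdot>) u\<close> to its velocity
  at \<open>t = 0\<close>.  Every \<open>\<Omega>\<close>-skew endomorphism is a combination of such rank one maps; hence \<open>sp(V)\<close> is
  the space of \<open>\<Omega>\<close>-skew endomorphisms, and no matrix exponential is needed.  In block form
  these are the matrices \<open>(A, B; C, -A\<^sup>t)\<close> with \<open>B\<close> and \<open>C\<close> symmetric.

  All five forms belong to one family with coefficients \<open>p, q\<^sub>1, q\<^sub>2, q\<^sub>3, r\<close>.  Evaluating \<open>L\<^sub>X \<omega>\<close> on
  triples of basis vectors turns \<open>L\<^sub>X \<omega> = 0\<close> into linear equations in the entries of \<open>A\<close>, \<open>B\<close> and \<open>C\<close>.\<close>

section \<open>Lie derivatives of forms with constant coefficients\<close>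

lemma dir_deriv_const: "dir_deriv v (\<lambda>_. c) p = 0"
  by (simp add: dir_deriv_def)

lemma dir_deriv_linear:
  assumes "linear h"
  shows "dir_deriv v h p = h v"
proof -
  have "(\<lambda>t. h (p + t *\<^sub>R v)) = (\<lambda>t. h p + t * h v)"
    using assms by (simp add: linear_add linear_scale)
  moreover have "((\<lambda>t. h p + t * h v) has_real_derivative h v) (at 0)"
    by (auto intro!: derivative_eq_intros)
  ultimately show ?thesis
    unfolding dir_deriv_def by (simp add: DERIV_imp_deriv)
qed

text \<open>The \<open>ext_d3\<close> term differentiates functions that are constant in the base
  point. In the other term each function of the base point is linear, so its derivative is its value
  at the direction, and \<open>p\<close> drops out.\<close>

lemma lie_derivative_const:
  assumes "linear X" and "\<And>v w. linear (\<lambda>u. \<omega> u v w)"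
  shows "lie_derivative X (\<lambda>_. \<omega>) p u v w = \<omega> (X u) v w - \<omega> (X v) u w + \<omega> (X w) u v"
proof -
  have "linear (\<lambda>q. \<omega> (X q) v w)" for v w
    using linear_compose[OF assms(1) assms(2)[of v w]] by (simp add: o_def)
  then show ?thesis
    by (simp add: lie_derivative_def ext_d2_def ext_d3_def interior_prod_def
        dir_deriv_linear dir_deriv_const)
qed

section \<open>Block matrices and their entries\<close>

lemma block_cases: obtains A B C D where "M = block A B C D"
proof
  show "M = block (\<chi> i j. M $ Inl i $ Inl j) (\<chi> i j. M $ Inl i $ Inr j)
                  (\<chi> i j. M $ Inr i $ Inl j) (\<chi> i j. M $ Inr i $ Inr j)"
    by (auto simp: block_def vec_eq_iff split: sum.split)
qed

lemma block_eq_iff: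
  "block A B C D = block A' B' C' D' \<longleftrightarrow> A = A' \<and> B = B' \<and> C = C' \<and> D = D'"
  by (auto simp: block_def vec_eq_iff split: sum.splits)

lemma mat3_eq_iff:
  "M = mat3 a b c d e f g h i \<longleftrightarrow>
     M$1$1 = a \<and> M$1$2 = b \<and> M$1$3 = c \<and>
     M$2$1 = d \<and> M$2$2 = e \<and> M$2$3 = f \<and>
     M$3$1 = g \<and> M$3$2 = h \<and> M$3$3 = i"
  by (simp add: mat3_def vec_eq_iff forall_3 vector_3 conj_assoc)

lemma mat3_nth [simp]:
  "mat3 a b c d e f g h i $1$1 = a" "mat3 a b c d e f g h i $1$2 = b"
  "mat3 a b c d e f g h i $1$3 = c" "mat3 a b c d e f g h i $2$1 = d"
  "mat3 a b c d e f g h i $2$2 = e" "mat3 a b c d e f g h i $2$3 = f"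
  "mat3 a b c d e f g h i $3$1 = g" "mat3 a b c d e f g h i $3$2 = h"
  "mat3 a b c d e f g h i $3$3 = i"
  by (simp_all add: mat3_def vector_3)

lemma transpose_mat3: "transpose (mat3 a b c d e f g h i) = mat3 a d g b e h c f i"
  by (simp add: mat3_eq_iff transpose_def)

lemma uminus_mat3: "- mat3 a b c d e f g h i = mat3 (-a) (-b) (-c) (-d) (-e) (-f) (-g) (-h) (-i)"
  by (simp add: mat3_eq_iff)

lemma zero_eq_mat3: "0 = mat3 0 0 0 0 0 0 0 0 0"
  by (simp add: mat3_eq_iff)

lemma transpose_eq_self_iff:
  fixes B :: "real^3^3"
  shows "transpose B = B \<longleftrightarrow> B$2$1 = B$1$2 \<and> B$3$1 = B$1$3 \<and> B$3$2 = B$2$3"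
  by (auto simp: transpose_def vec_eq_iff forall_3)

section \<open>Coordinates in a symplectic basis\<close>

locale symplectic_coordinates =
  fixes \<Omega> :: "'v::real_vector \<Rightarrow> 'v \<Rightarrow> real"
    and e f :: "3 \<Rightarrow> 'v"
    and es fs :: "3 \<Rightarrow> 'v \<Rightarrow> real"
  assumes symplectic_basis: "symplectic_basis \<Omega> e f es fs"
begin

lemma linear_es: "linear (es i)" and linear_fs: "linear (fs i)"
  and es_e [simp]: "es i (e j) = (if i = j then 1 else 0)"
  and es_f [simp]: "es i (f j) = 0"
  and fs_f [simp]: "fs i (f j) = (if i = j then 1 else 0)"
  and fs_e [simp]: "fs i (e j) = 0"
  using symplectic_basis by (auto simp: symplectic_basis_def dual_basis_def)

lemmas coord_simps =
  linear_add[OF linear_es] linear_add[OF linear_fs]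
  linear_scale[OF linear_es] linear_scale[OF linear_fs]
  linear_sum[OF linear_es] linear_sum[OF linear_fs]

lemma \<Omega>_coord: "\<Omega> u v = (\<Sum>i\<in>UNIV. es i u * fs i v - es i v * fs i u)"
  using symplectic_basis by (simp add: symplectic_basis_def wedge2_def)

lemma linear_\<Omega>: "linear (\<Omega> u)"
  by (rule linearI)
    (simp_all add: \<Omega>_coord coord_simps algebra_simps sum_distrib_left sum.distrib sum_subtractf)

lemma \<Omega>_antisym: "\<Omega> u v = - \<Omega> v u"
  by (simp add: \<Omega>_coord sum_subtractf)

lemmas \<Omega>_simps =
  linear_add[OF linear_\<Omega>] linear_scale[OF linear_\<Omega>]
  linear_diff[OF linear_\<Omega>]

lemma linear_\<Omega>_left: "linear (\<lambda>u. \<Omega> u v)"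
  by (subst \<Omega>_antisym) (intro linear_compose_neg linear_\<Omega>)

lemmas \<Omega>_left_simps =
  linear_add[OF linear_\<Omega>_left] linear_scale[OF linear_\<Omega>_left]
  linear_diff[OF linear_\<Omega>_left]

lemma linear_eq_on_basis:
  assumes "linear F" "linear G" "\<And>i. F (e i) = G (e i)" "\<And>i. F (f i) = G (f i)"
  shows "F v = G v"
proof (rule linear_eq_on_span[OF assms(1,2)])
  show "v \<in> span (range (case_sum e f))"
    using symplectic_basis by (simp add: symplectic_basis_def is_basis_def)
  show "F x = G x" if "x \<in> range (case_sum e f)" for x
    using that assms(3,4) by (auto split: sum.splits)
qed

lemma bilinear_eq_0_iff:
  fixes T :: "'v \<Rightarrow> 'v \<Rightarrow> real"
  assumes "\<And>v. linear (\<lambda>u. T u v)" "\<And>u. linear (T u)"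
  shows "(\<forall>u v. T u v = 0) \<longleftrightarrow> (\<forall>i j. T (case_sum e f i) (case_sum e f j) = 0)"
proof (intro iffI allI)
  fix u v assume "\<forall>i j. T (case_sum e f i) (case_sum e f j) = 0"
  then have basis: "T (case_sum e f i) (case_sum e f j) = 0" for i j
    by blast
  have 1: "T (case_sum e f i) v = 0" for i v
    by (rule linear_eq_on_basis[OF assms(2) linear_zero])
      (use basis[of i "Inl _"] basis[of i "Inr _"] in auto)
  show "T u v = 0"
    by (rule linear_eq_on_basis[OF assms(1) linear_zero])
      (use 1[of "Inl _"] 1[of "Inr _"] in auto)
qed simp

text \<open>A basis vector in the first slot leaves a bilinear map, to which
  \<open>bilinear_eq_0_iff\<close> applies; linearity in the first slot then passes to arbitrary
  vectors.\<close>

lemma trilinear_eq_0_iff: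
  fixes T :: "'v \<Rightarrow> 'v \<Rightarrow> 'v \<Rightarrow> real"
  assumes "\<And>v w. linear (\<lambda>u. T u v w)" "\<And>u w. linear (\<lambda>v. T u v w)" "\<And>u v. linear (T u v)"
  shows "(\<forall>u v w. T u v w = 0) \<longleftrightarrow>
    (\<forall>i j k. T (case_sum e f i) (case_sum e f j) (case_sum e f k) = 0)"
proof (intro iffI allI)
  fix u v w assume "\<forall>i j k. T (case_sum e f i) (case_sum e f j) (case_sum e f k) = 0"
  then have 1: "T (case_sum e f i) v w = 0" for i v w
    using bilinear_eq_0_iff[OF assms(2,3)] by blast
  show "T u v w = 0"
    by (rule linear_eq_on_basis[OF assms(1) linear_zero])
      (use 1[of "Inl _"] 1[of "Inr _"] in auto)
qed simp

lemma coord_expansion: "v = (\<Sum>i\<in>UNIV. es i v *\<^sub>R e i + fs i v *\<^sub>R f i)"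
proof -
  have "linear (\<lambda>v. \<Sum>i\<in>UNIV. es i v *\<^sub>R e i + fs i v *\<^sub>R f i)"
    by (rule linearI) (simp_all add: coord_simps scaleR_sum_right sum.distrib algebra_simps)
  from linear_eq_on_basis[OF linear_ident this] show ?thesis
    by (simp add: if_distrib[of "\<lambda>c. c *\<^sub>R _"] cong: if_cong)
qed

text \<open>Coordinates become pairings with \<Omega>, so that basis expansions turn into sums of
  the rank one maps generated by transvections.\<close>

lemma es_\<Omega>: "es i v = - \<Omega> (f i) v" and fs_\<Omega>: "fs i v = \<Omega> (e i) v"
  by (simp_all add: \<Omega>_coord sum_negf if_distrib[of "\<lambda>c. _ * c"]
      if_distrib[of "\<lambda>c. c * _"] cong: if_cong)

lemma \<Omega>_basis:
  "\<Omega> v (f i) = es i v" "\<Omega> v (e i) = - fs i v" "\<Omega> (f i) v = - es i v" "\<Omega> (e i) v = fs i v"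
  using \<Omega>_antisym[of v "f i"] \<Omega>_antisym[of v "e i"] by (simp_all add: es_\<Omega> fs_\<Omega>)


subsection \<open>The Lie algebra of the symplectic group\<close>

text \<open>Differentiate the constant function \<open>\<Omega> (g t u) (g t v)\<close> at 0. The
  weak derivative suffices because \<Omega> is a polynomial in the linear functionals
  \<open>es i\<close> and \<open>fs i\<close>.\<close>

lemma sp_imp_skew:
  assumes "X \<in> sp \<Omega>"
  shows "\<Omega> (X u) v + \<Omega> u (X v) = 0"
proof -
  obtain g where g: "\<And>t. g t \<in> Sp \<Omega>" "g 0 = id"
    and D: "\<And>v \<phi>. linear \<phi> \<Longrightarrow> ((\<lambda>t::real. \<phi> (g t v)) has_real_derivative \<phi> (X v)) (at 0)"
    using assms unfolding sp_def lie_algebra_of_def by blast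
  have "((\<lambda>t. \<Omega> (g t u) (g t v)) has_real_derivative (\<Omega> (X u) v + \<Omega> u (X v))) (at 0)"
    unfolding \<Omega>_coord
    using D[OF linear_es] D[OF linear_fs]
    by (auto intro!: derivative_eq_intros simp: g(2) sum.distrib[symmetric] algebra_simps)
  moreover have "(\<lambda>t. \<Omega> (g t u) (g t v)) = (\<lambda>t. \<Omega> u v)"
    using g(1) by (auto simp: Sp_def)
  ultimately show ?thesis
    using DERIV_unique[OF _ DERIV_const] by metis
qed

text \<open>Since \<open>\<Omega> u u = 0\<close>, the parameter \<open>- c\<close> gives the
  inverse, and the two terms linear in \<open>c\<close> of the transformed \<Omega> cancel by
  antisymmetry.\<close>

lemma transvection_in_Sp: "(\<lambda>v. v + (c * \<Omega> u v) *\<^sub>R u) \<in> Sp \<Omega>"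
proof -
  have uu: "\<Omega> u u = 0"
    using \<Omega>_antisym[of u u] by simp
  have "linear (\<lambda>v. v + (c * \<Omega> u v) *\<^sub>R u)"
    by (rule linearI) (simp_all add: \<Omega>_simps algebra_simps)
  moreover have "bij (\<lambda>v. v + (c * \<Omega> u v) *\<^sub>R u)"
    by (rule o_bij[where g = "\<lambda>v. v - (c * \<Omega> u v) *\<^sub>R u"]) (simp_all add: fun_eq_iff \<Omega>_simps uu)
  moreover have "\<Omega> (v + (c * \<Omega> u v) *\<^sub>R u) (w + (c * \<Omega> u w) *\<^sub>R u) = \<Omega> v w" for v w
    using \<Omega>_antisym[of v u] by (simp add: \<Omega>_simps \<Omega>_left_simps uu)
  ultimately show ?thesis
    by (simp add: Sp_def)
qed

lemma Sp_comp: "g \<in> Sp \<Omega> \<Longrightarrow> h \<in> Sp \<Omega> \<Longrightarrow> (\<lambda>v. g (h v)) \<in> Sp \<Omega>"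
  using linear_compose[of h g] bij_comp[of h g] by (auto simp: Sp_def o_def)

lemma sp_zero: "(\<lambda>_. 0) \<in> sp \<Omega>"
proof -
  have "\<exists>g :: real \<Rightarrow> 'v \<Rightarrow> 'v. (\<forall>t. g t \<in> Sp \<Omega>) \<and> g 0 = id \<and>
      (\<forall>v \<phi>. linear \<phi> \<longrightarrow> ((\<lambda>t. \<phi> (g t v)) has_real_derivative \<phi> 0) (at 0))"
    by (rule exI[of _ "\<lambda>_. id"]) (auto simp: Sp_def linear_0 linear_id[unfolded id_def] linear_id)
  then show ?thesis
    by (simp add: sp_def lie_algebra_of_def linear_zero)
qed

lemma sp_add_transvection:
  assumes "X \<in> sp \<Omega>"
  shows "(\<lambda>v. X v + (c * \<Omega> u v) *\<^sub>R u) \<in> sp \<Omega>"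
proof -
  obtain g where X: "linear X" and g: "\<And>t. g t \<in> Sp \<Omega>" "g 0 = id"
    and D: "\<And>v \<phi>. linear \<phi> \<Longrightarrow> ((\<lambda>t::real. \<phi> (g t v)) has_real_derivative \<phi> (X v)) (at 0)"
    using assms unfolding sp_def lie_algebra_of_def by blast
  define h where "h = (\<lambda>t v. g t v + ((t * c) * \<Omega> u (g t v)) *\<^sub>R u)"
  have "h t \<in> Sp \<Omega>" for t
    unfolding h_def by (rule Sp_comp[OF transvection_in_Sp g(1)])
  moreover have "h 0 = id"
    by (simp add: h_def g(2) id_def)
  \<comment> \<open>In the product rule for \<open>(t * c) * \<Omega> u (g t v)\<close> the term
    containing the derivative of \<open>g\<close> carries the factor \<open>t = 0\<close>; what is
    left is \<open>c * \<Omega> u v\<close>, as \<open>g 0 = id\<close>.\<close>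
  moreover have "((\<lambda>t. \<phi> (h t v)) has_real_derivative \<phi> (X v + (c * \<Omega> u v) *\<^sub>R u)) (at 0)"
    if \<phi>: "linear \<phi>" for v \<phi>
    unfolding h_def linear_add[OF \<phi>] linear_scale[OF \<phi>]
    using DERIV_add[OF D[OF \<phi>, of v] DERIV_cmult_right[OF
        DERIV_mult[OF DERIV_cmult_right[OF DERIV_ident, of c] D[OF linear_\<Omega>, of u v]], of "\<phi> u"]]
    by (simp add: g(2))
  moreover have "linear (\<lambda>v. X v + (c * \<Omega> u v) *\<^sub>R u)"
    using X by (intro linearI) (simp_all add: linear_add linear_scale \<Omega>_simps algebra_simps)
  ultimately show ?thesis
    unfolding sp_def lie_algebra_of_def by blast
qed

text \<open>Polarization: the symmetric product is the transvection term of \<open>u + w\<close>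
  minus those of \<open>u\<close> and of \<open>w\<close>.\<close>

lemma sp_add_sym_product:
  assumes "X \<in> sp \<Omega>"
  shows "(\<lambda>v. X v + c *\<^sub>R (\<Omega> u v *\<^sub>R w + \<Omega> w v *\<^sub>R u)) \<in> sp \<Omega>"
proof -
  have "(\<lambda>v. X v + (c * \<Omega> (u + w) v) *\<^sub>R (u + w) + (- c * \<Omega> u v) *\<^sub>R u + (- c * \<Omega> w v) *\<^sub>R w) \<in> sp \<Omega>"
    by (intro sp_add_transvection assms)
  then show ?thesis
    by (simp add: \<Omega>_left_simps algebra_simps)
qed

text \<open>Averaging the two expansions of \<open>X v\<close>, applying \<open>X\<close> to that of \<open>v\<close> or expanding \<open>X v\<close> itself,
  makes the expression symmetric, which is what the symmetric products require.\<close>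

lemma skew_imp_sp:
  assumes X: "linear X" and skew: "\<And>u v. \<Omega> (X u) v + \<Omega> u (X v) = 0"
  shows "X \<in> sp \<Omega>"
proof -
  let ?N = "\<lambda>u w v. \<Omega> u v *\<^sub>R w + \<Omega> w v *\<^sub>R u"
  have sk: "\<Omega> u (X v) = - \<Omega> (X u) v" for u v
    using skew[of u v] by simp
  have X1: "X v = (\<Sum>i\<in>UNIV. \<Omega> (e i) v *\<^sub>R X (f i) - \<Omega> (f i) v *\<^sub>R X (e i))" for v
  proof -
    have "X v = X (\<Sum>i\<in>UNIV. es i v *\<^sub>R e i + fs i v *\<^sub>R f i)"
      by (rule arg_cong[OF coord_expansion])
    also have "\<dots> = (\<Sum>i\<in>UNIV. \<Omega> (e i) v *\<^sub>R X (f i) - \<Omega> (f i) v *\<^sub>R X (e i))"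
      by (simp add: linear_sum[OF X] linear_diff[OF X] linear_scale[OF X] es_\<Omega> fs_\<Omega>)
    finally show ?thesis .
  qed
  \<comment> \<open>Skewness enters here: it moves \<open>X\<close> from the argument
    \<open>v\<close> onto the basis vectors.\<close>
  have X2: "X v = (\<Sum>i\<in>UNIV. \<Omega> (X (f i)) v *\<^sub>R e i - \<Omega> (X (e i)) v *\<^sub>R f i)" for v
  proof -
    have "X v = (\<Sum>i\<in>UNIV. es i (X v) *\<^sub>R e i + fs i (X v) *\<^sub>R f i)"
      by (rule coord_expansion)
    also have "\<dots> = (\<Sum>i\<in>UNIV. \<Omega> (X (f i)) v *\<^sub>R e i - \<Omega> (X (e i)) v *\<^sub>R f i)"
      by (simp add: es_\<Omega> fs_\<Omega> sk)
    finally show ?thesis .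
  qed
  \<comment> \<open>The leading 0 is the map of \<open>sp_zero\<close>;
    \<open>sp_add_sym_product\<close> adds the six products to it one at a time. The signs are those
    of the two expansions, and 1/2 comes from averaging.\<close>
  let ?Y = "\<lambda>v. 0 + (1/2) *\<^sub>R ?N (e 1) (X (f 1)) v + (-1/2) *\<^sub>R ?N (f 1) (X (e 1)) v
       + (1/2) *\<^sub>R ?N (e 2) (X (f 2)) v + (-1/2) *\<^sub>R ?N (f 2) (X (e 2)) v
       + (1/2) *\<^sub>R ?N (e 3) (X (f 3)) v + (-1/2) *\<^sub>R ?N (f 3) (X (e 3)) v"
  have "X v = ?Y v" for v
  proof -
    have "X v = (1/2) *\<^sub>R (X v + X v)"
      by simp
    also have "\<dots> = (1/2) *\<^sub>R
        ((\<Sum>i\<in>UNIV. \<Omega> (e i) v *\<^sub>R X (f i) - \<Omega> (f i) v *\<^sub>R X (e i)) +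
         (\<Sum>i\<in>UNIV. \<Omega> (X (f i)) v *\<^sub>R e i - \<Omega> (X (e i)) v *\<^sub>R f i))"
      unfolding X1[symmetric] X2[symmetric] ..
    also have "\<dots> = ?Y v"
      by (simp add: sum_3 scaleR_add_right scaleR_diff_right)
    finally show ?thesis .
  qed
  then have "X = ?Y"
    by (rule ext)
  moreover have "?Y \<in> sp \<Omega>"
    by (intro sp_add_sym_product sp_zero)
  ultimately show ?thesis
    by simp
qed

lemma sp_iff: "X \<in> sp \<Omega> \<longleftrightarrow> linear X \<and> (\<forall>u v. \<Omega> (X u) v + \<Omega> u (X v) = 0)"
  using sp_imp_skew skew_imp_sp by (auto simp: sp_def lie_algebra_of_def)


subsection \<open>Stabilizers in matrix form\<close>

definition normal_form where
  "normal_form p q1 q2 q3 r u v w =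
     p * wedge3 (es 1) (es 2) (es 3) u v w + q1 * wedge3 (fs 1) (es 2) (es 3) u v w
     + q2 * wedge3 (fs 2) (es 1) (es 3) u v w + q3 * wedge3 (fs 3) (es 1) (es 2) u v w
     + r * wedge3 (fs 1) (fs 2) (fs 3) u v w"

text \<open>A right inverse of \<open>matrix_wrt\<close> in the row convention; it supplies the
  endomorphism when a given matrix has to be realized.\<close>

definition map_of_blocks :: "real^3^3 \<Rightarrow> real^3^3 \<Rightarrow> real^3^3 \<Rightarrow> real^3^3 \<Rightarrow> 'v \<Rightarrow> 'v" where
  "map_of_blocks A B C D v =
     (\<Sum>i\<in>UNIV. es i v *\<^sub>R (\<Sum>j\<in>UNIV. A$i$j *\<^sub>R e j + B$i$j *\<^sub>R f j)
            + fs i v *\<^sub>R (\<Sum>j\<in>UNIV. C$i$j *\<^sub>R e j + D$i$j *\<^sub>R f j))"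

lemma linear_map_of_blocks: "linear (map_of_blocks A B C D)"
  by (rule linearI)
    (simp_all add: map_of_blocks_def coord_simps scaleR_sum_right sum.distrib algebra_simps)

lemma matrix_wrt_eq_block_iff:
  "matrix_wrt e f es fs X = block A B C D \<longleftrightarrow>
     (\<forall>i j. es j (X (e i)) = A$i$j \<and> fs j (X (e i)) = B$i$j \<and>
            es j (X (f i)) = C$i$j \<and> fs j (X (f i)) = D$i$j)"
  by (auto simp: matrix_wrt_def block_def vec_eq_iff split: sum.splits)

lemma matrix_map_of_blocks: "matrix_wrt e f es fs (map_of_blocks A B C D) = block A B C D"
  unfolding matrix_wrt_eq_block_iff
  by (simp add: map_of_blocks_def coord_simps if_distrib[of "\<lambda>c. _ * c"]
      if_distrib[of "\<lambda>c. c * _"] cong: if_cong)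

text \<open>Skewness is tested on pairs of basis vectors: two \<open>e\<close> give the condition on
  \<open>B\<close>, two \<open>f\<close> that on \<open>C\<close>, and a mixed pair relates
  \<open>A\<close> and \<open>D\<close>.\<close>

lemma sp_matrix_iff:
  assumes X: "linear X" and M: "matrix_wrt e f es fs X = block A B C D"
  shows "X \<in> sp \<Omega> \<longleftrightarrow> D = - transpose A \<and> transpose B = B \<and> transpose C = C"
proof -
  let ?T = "\<lambda>u v. \<Omega> (X u) v + \<Omega> u (X v)"
  note M' = M[unfolded matrix_wrt_eq_block_iff, rule_format]
  have T: "linear (\<lambda>u. ?T u v)" "linear (?T u)" for u v
    by (intro linear_compose_add linear_\<Omega> linear_\<Omega>_left
        linear_compose[OF X linear_\<Omega>, unfolded o_def] linear_compose[OF X linear_\<Omega>_left, unfolded o_def])+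
  have "X \<in> sp \<Omega> \<longleftrightarrow> (\<forall>i j. ?T (case_sum e f i) (case_sum e f j) = 0)"
    unfolding sp_iff bilinear_eq_0_iff[OF T, symmetric] using X by simp
  also have "\<dots> \<longleftrightarrow> D = - transpose A \<and> transpose B = B \<and> transpose C = C"
    by (simp add: split_sum_all \<Omega>_basis M' vec_eq_iff transpose_def) (smt (verit))
  finally show ?thesis .
qed

text \<open>The equations are the values of \<open>L\<^sub>X \<omega>\<close> on triples of basis vectors, ordered by the number of
  \<open>f\<close>'s in the triple: one equation for none, six for one, six for two, one for three.
  The minus signs at \<open>q\<^sub>2\<close> come from \<open>f\<^sub>2\<^sup>* \<and> e\<^sub>1\<^sup>* \<and> e\<^sub>3\<^sup>* = - e\<^sub>1\<^sup>* \<and> f\<^sub>2\<^sup>* \<and> e\<^sub>3\<^sup>*\<close>.\<close>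

definition stabilizer_equations ::
  "real \<Rightarrow> real \<Rightarrow> real \<Rightarrow> real \<Rightarrow> real \<Rightarrow> real^3^3 \<Rightarrow> real^3^3 \<Rightarrow> real^3^3 \<Rightarrow> bool" where
  "stabilizer_equations p q1 q2 q3 r A B C \<longleftrightarrow>
    p * trace A + q1 * B$1$1 - q2 * B$2$2 + q3 * B$3$3 = 0 \<and>
    p * C$1$1 + q1 * (trace A - 2 * A$1$1) = 0 \<and>
    p * C$2$2 - q2 * (trace A - 2 * A$2$2) = 0 \<and>
    p * C$3$3 + q3 * (trace A - 2 * A$3$3) = 0 \<and>
    p * C$1$2 - q1 * A$1$2 + q2 * A$2$1 = 0 \<and>
    p * C$1$3 - q1 * A$1$3 - q3 * A$3$1 = 0 \<and>
    p * C$2$3 + q2 * A$2$3 - q3 * A$3$2 = 0 \<and>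
    r * B$1$1 + q3 * C$2$2 - q2 * C$3$3 = 0 \<and>
    r * B$2$2 + q3 * C$1$1 + q1 * C$3$3 = 0 \<and>
    r * B$3$3 - q2 * C$1$1 + q1 * C$2$2 = 0 \<and>
    r * B$1$2 = q3 * C$1$2 \<and> r * B$1$3 = - q2 * C$1$3 \<and> r * B$2$3 = q1 * C$2$3 \<and>
    r * A$1$1 + r * A$2$2 + r * A$3$3 = 0"

lemma linear_normal_form:
  "linear (\<lambda>u. normal_form p q1 q2 q3 r u v w)"
  "linear (\<lambda>v. normal_form p q1 q2 q3 r u v w)"
  "linear (\<lambda>w. normal_form p q1 q2 q3 r u v w)"
  by (rule linearI; simp add: normal_form_def wedge3_def coord_simps; simp add: algebra_simps)+

lemma stabilizer_matrix_iff:
  assumes X: "linear X" and M: "matrix_wrt e f es fs X = block A B C (- transpose A)"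
    and B: "transpose B = B" and C: "transpose C = C"
  shows "(\<forall>x u v w. lie_derivative X (\<lambda>_. normal_form p q1 q2 q3 r) x u v w = 0) \<longleftrightarrow>
    stabilizer_equations p q1 q2 q3 r A B C"
proof -
  let ?\<omega> = "normal_form p q1 q2 q3 r"
  let ?T = "\<lambda>u v w. ?\<omega> (X u) v w - ?\<omega> (X v) u w + ?\<omega> (X w) u v"
  let ?b = "case_sum e f"
  note M' = M[unfolded matrix_wrt_eq_block_iff, rule_format]
  have sym: "B$j$i = B$i$j" "C$j$i = C$i$j" for i j
    using B C by (auto simp: vec_eq_iff transpose_def)
  note eval = normal_form_def wedge3_def M' transpose_def trace_def sum_3
    sym[of 2 1] sym[of 3 1] sym[of 3 2]
  note lin = linear_normal_form linear_compose[OF X linear_normal_form(1), unfolded o_def]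
  have T: "linear (\<lambda>u. ?T u v w)" "linear (\<lambda>v. ?T u v w)" "linear (?T u v)" for u v w
    by (intro linear_compose_add linear_compose_sub lin)+
  have "(\<forall>u v w. ?T u v w = 0) \<longleftrightarrow> (\<forall>i j k. ?T (?b i) (?b j) (?b k) = 0)"
    by (rule trilinear_eq_0_iff[OF T])
  also have "\<dots> \<longleftrightarrow> stabilizer_equations p q1 q2 q3 r A B C"
  proof
    assume "\<forall>i j k. ?T (?b i) (?b j) (?b k) = 0"
    then have T: "?T (?b i) (?b j) (?b k) = 0" for i j k
      by blast
    \<comment> \<open>Of the twenty triples of distinct basis vectors fourteen are used, the
      dimension of the space of effective 3-forms. For \<open>X\<close> in
      \<open>sp \<Omega>\<close> the derivative is again effective, which pairs up the twelve
      triples containing some \<open>e i\<close> together with \<open>f i\<close>; one of each pair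
      is taken.\<close>
    show "stabilizer_equations p q1 q2 q3 r A B C"
      unfolding stabilizer_equations_def
      using T[of "Inl 1" "Inl 2" "Inl 3"]
        T[of "Inr 1" "Inl 2" "Inl 3"] T[of "Inl 1" "Inr 2" "Inl 3"] T[of "Inl 1" "Inl 2" "Inr 3"]
        T[of "Inr 2" "Inl 2" "Inl 3"] T[of "Inr 3" "Inl 2" "Inl 3"] T[of "Inl 1" "Inr 3" "Inl 3"]
        T[of "Inl 1" "Inr 2" "Inr 3"] T[of "Inr 1" "Inl 2" "Inr 3"] T[of "Inr 1" "Inr 2" "Inl 3"]
        T[of "Inl 2" "Inr 2" "Inr 3"] T[of "Inl 3" "Inr 2" "Inr 3"] T[of "Inr 1" "Inl 3" "Inr 3"]
        T[of "Inr 1" "Inr 2" "Inr 3"]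
      by (simp add: eval) (simp add: algebra_simps)
  next
    assume "stabilizer_equations p q1 q2 q3 r A B C"
    then show "\<forall>i j k. ?T (?b i) (?b j) (?b k) = 0"
      unfolding stabilizer_equations_def
      by (simp add: split_sum_all forall_3 eval) (simp add: algebra_simps)
  qed
  finally show ?thesis
    using lie_derivative_const[OF X linear_normal_form(1)] by simp
qed

text \<open>Reduces each normal form to solving linear equations for the blocks.\<close>

lemma matrix_stabilizer:
  "matrix_wrt e f es fs ` stabilizer \<Omega> (normal_form p q1 q2 q3 r) =
   {block A B C (- transpose A) | A B C. transpose B = B \<and> transpose C = C \<and>
    stabilizer_equations p q1 q2 q3 r A B C}" (is "?S = ?T")
proof (rule set_eqI, rule iffI)
  fix M assume "M \<in> ?S"
  then obtain X where X: "X \<in> sp \<Omega>" and M: "M = matrix_wrt e f es fs X"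
    and L: "\<forall>x u v w. lie_derivative X (\<lambda>_. normal_form p q1 q2 q3 r) x u v w = 0"
    by (auto simp: stabilizer_def)
  obtain A B C D where bl: "M = block A B C D"
    by (rule block_cases)
  have lin: "linear X"
    using X by (simp add: sp_iff)
  have D: "D = - transpose A" and sym: "transpose B = B" "transpose C = C"
    using sp_matrix_iff[OF lin] X bl M by auto
  show "M \<in> ?T"
    unfolding bl D
    using stabilizer_matrix_iff[OF lin _ sym, of A p q1 q2 q3 r] L sym M bl D by blast
next
  fix M assume "M \<in> ?T"
  then obtain A B C where M: "M = block A B C (- transpose A)"
    and sym: "transpose B = B" "transpose C = C"
    and eqs: "\<forall>x u v w. lie_derivative (map_of_blocks A B C (- transpose A))
       (\<lambda>_. normal_form p q1 q2 q3 r) x u v w = 0"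
    by (auto simp: stabilizer_matrix_iff[OF linear_map_of_blocks matrix_map_of_blocks])
  have "map_of_blocks A B C (- transpose A) \<in> stabilizer \<Omega> (normal_form p q1 q2 q3 r)"
    using sp_matrix_iff[OF linear_map_of_blocks matrix_map_of_blocks] sym eqs
    by (auto simp: stabilizer_def)
  then show "M \<in> ?S"
    unfolding M matrix_map_of_blocks[symmetric] by (rule imageI)
qed

section \<open>Solving the equations for each normal form\<close>

text \<open>With \<open>p = 1\<close> and vanishing \<open>q\<close>, the equations decouple: they
  force \<open>C = 0\<close>, \<open>\<gamma> * B = 0\<close> entrywise and
  \<open>trace A = 0\<close>.\<close>

lemma stabilizer_form_1:
  assumes "\<gamma> \<noteq> 0"
  shows "matrix_wrt e f es fs ` stabilizer \<Omega> (normal_form 1 0 0 0 \<gamma>) =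
    {block B 0 0 (- transpose B) | B. B \<in> sl3}" (is "?L = ?R")
proof (intro equalityI subsetI)
  fix M
  {
    assume "M \<in> ?L"
    then obtain A B C where M: "M = block A B C (- transpose A)"
      and sym: "transpose B = B" "transpose C = C"
      and eqs: "stabilizer_equations 1 0 0 0 \<gamma> A B C"
      by (auto simp: matrix_stabilizer)
    have "B = mat3 0 0 0 0 0 0 0 0 0" "C = mat3 0 0 0 0 0 0 0 0 0"
      using eqs sym assms
      by (simp_all add: mat3_eq_iff stabilizer_equations_def transpose_eq_self_iff)
    then show "M \<in> ?R"
      using eqs by (auto simp: M stabilizer_equations_def sl3_def zero_eq_mat3)
  next
    assume "M \<in> ?R"
    then obtain A where M: "M = block A 0 0 (- transpose A)" and A: "trace A = 0"
      by (auto simp: sl3_def)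
    then have "\<gamma> * (A$1$1 + A$2$2 + A$3$3) = 0"
      by (simp add: trace_def sum_3)
    then have "stabilizer_equations 1 0 0 0 \<gamma> A 0 0"
      using A unfolding stabilizer_equations_def distrib_left by simp
    moreover have "transpose (0::real^3^3) = 0"
      by (simp add: transpose_eq_self_iff)
    ultimately show "M \<in> ?L"
      using M unfolding matrix_stabilizer by blast
  }
qed

text \<open>The equations \<open>trace A = 2 * A$i$i\<close> add up to
  \<open>3 * trace A = 2 * trace A\<close>, so the diagonal of \<open>A\<close> vanishes. With
  \<open>E = diag(1,-1,1)\<close> the others say that \<open>E A\<close> is skew, \<open>E B\<close>
  has trace 0 and \<open>C = - r E B E\<close>. The parameter \<open>r\<close> is \<nu>^2, or 0 for
  form 4.\<close>

lemma stabilizer_form_2: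
  "matrix_wrt e f es fs ` stabilizer \<Omega> (normal_form 0 1 1 1 r) =
      {block
           (mat3 0 \<alpha> \<beta>
                 \<alpha> 0 \<gamma>
                 (-\<beta>) \<gamma> 0)
           (mat3 l1 x1 x2
                 x1 l2 x3
                 x2 x3 l3)
           (mat3 (-(r * l1)) (r * x1) (-(r * x2))
                 (r * x1) (-(r * l2)) (r * x3)
                 (-(r * x2)) (r * x3) (-(r * l3)))
           (mat3 0 (-\<alpha>) \<beta>
                 (-\<alpha>) 0 (-\<gamma>)
                 (-\<beta>) (-\<gamma>) 0)
         | \<alpha> \<beta> \<gamma> l1 l2 l3 x1 x2 x3. l1 - l2 + l3 = 0}" (is "?L = ?R")
proof (intro equalityI subsetI)
  fix M
  {
    assume "M \<in> ?L"
    then obtain A B C where M: "M = block A B C (- transpose A)"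
      and sym: "transpose B = B" "transpose C = C"
      and eqs: "stabilizer_equations 0 1 1 1 r A B C"
      by (auto simp: matrix_stabilizer)
    have "B$1$1 - B$2$2 + B$3$3 = 0"
      using eqs by (simp add: stabilizer_equations_def)
    \<comment> \<open>The products \<open>r * B$i$i\<close> are atoms for linear arithmetic, so the
      relation is needed multiplied by \<open>r\<close> as well.\<close>
    then have "r * (B$1$1 - B$2$2 + B$3$3) = 0"
      by simp
    then have "r * B$1$1 - r * B$2$2 + r * B$3$3 = 0"
      by (simp only: distrib_left right_diff_distrib)
    with eqs sym show "M \<in> ?R"
      unfolding M stabilizer_equations_def transpose_eq_self_iff trace_def sum_3
      by (simp add: block_eq_iff mat3_eq_iff transpose_def; linarith)
  next
    have rel: "l2 = l1 + l3" if "l1 - l2 + l3 = 0" for l1 l2 l3 :: real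
      using that by simp
    assume "M \<in> ?R"
    then show "M \<in> ?L"
      unfolding matrix_stabilizer stabilizer_equations_def transpose_eq_self_iff trace_def sum_3
      by - (elim CollectE exE conjE, drule rel,
        simp add: block_eq_iff transpose_mat3 uminus_mat3, simp add: algebra_simps)
  }
qed

text \<open>As for form 2 with \<open>E\<close> the identity: \<open>A\<close> is skew, hence equal
  to \<open>- transpose A\<close>, and \<open>C = - r B\<close> with \<open>B\<close> of trace 0.
  For \<open>r > 0\<close> this is su(3) in real form, through
  \<open>A + i sqrt(r) B\<close>.\<close>

lemma stabilizer_form_3:
  "matrix_wrt e f es fs ` stabilizer \<Omega> (normal_form 0 1 (-1) 1 (- r)) =
      {block
           (mat3 0 \<alpha> \<beta>
                 (-\<alpha>) 0 \<gamma>
                 (-\<beta>) (-\<gamma>) 0)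
           (mat3 l1 x1 x2
                 x1 l2 x3
                 x2 x3 l3)
           (mat3 (-(r * l1)) (-(r * x1)) (-(r * x2))
                 (-(r * x1)) (-(r * l2)) (-(r * x3))
                 (-(r * x2)) (-(r * x3)) (-(r * l3)))
           (mat3 0 \<alpha> \<beta>
                 (-\<alpha>) 0 \<gamma>
                 (-\<beta>) (-\<gamma>) 0)
         | \<alpha> \<beta> \<gamma> l1 l2 l3 x1 x2 x3. l1 + l2 + l3 = 0}" (is "?L = ?R")
proof (intro equalityI subsetI)
  fix M
  {
    assume "M \<in> ?L"
    then obtain A B C where M: "M = block A B C (- transpose A)"
      and sym: "transpose B = B" "transpose C = C"
      and eqs: "stabilizer_equations 0 1 (-1) 1 (- r) A B C"
      by (auto simp: matrix_stabilizer)
    have "B$1$1 + B$2$2 + B$3$3 = 0"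
      using eqs by (simp add: stabilizer_equations_def)
    then have "r * (B$1$1 + B$2$2 + B$3$3) = 0"
      by simp
    then have "r * B$1$1 + r * B$2$2 + r * B$3$3 = 0"
      by (simp only: distrib_left right_diff_distrib)
    with eqs sym show "M \<in> ?R"
      unfolding M stabilizer_equations_def transpose_eq_self_iff trace_def sum_3
      by (simp add: block_eq_iff mat3_eq_iff transpose_def; linarith)
  next
    have rel: "l2 = - l1 - l3" if "l1 + l2 + l3 = 0" for l1 l2 l3 :: real
      using that by simp
    assume "M \<in> ?R"
    then show "M \<in> ?L"
      unfolding matrix_stabilizer stabilizer_equations_def transpose_eq_self_iff trace_def sum_3
      by - (elim CollectE exE conjE, drule rel,
        simp add: block_eq_iff transpose_mat3 uminus_mat3, simp add: algebra_simps)
  }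
qed

text \<open>For \<open>r = 0\<close> the equations for \<open>C\<close> are homogeneous with only
  the zero solution. The conditions on \<open>A\<close> and \<open>B\<close> are those of form 2
  with \<open>E = diag(1,-1,-1)\<close>.\<close>

lemma stabilizer_form_5:
  "matrix_wrt e f es fs ` stabilizer \<Omega> (normal_form 0 1 1 (-1) 0) =
      {block
           (mat3 0 \<alpha> \<beta>
                 \<alpha> 0 \<gamma>
                 \<beta> (-\<gamma>) 0)
           (mat3 l1 x1 x2
                 x1 l2 x3
                 x2 x3 l3)
           0
           (mat3 0 (-\<alpha>) (-\<beta>)
                 (-\<alpha>) 0 \<gamma>
                 (-\<beta>) (-\<gamma>) 0)
         | \<alpha> \<beta> \<gamma> l1 l2 l3 x1 x2 x3. l1 - l2 - l3 = 0}" (is "?L = ?R")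
proof (intro equalityI subsetI)
  fix M
  {
    assume "M \<in> ?L"
    then show "M \<in> ?R"
      unfolding matrix_stabilizer stabilizer_equations_def transpose_eq_self_iff trace_def sum_3 zero_eq_mat3
      by (elim CollectE exE conjE) (simp add: block_eq_iff mat3_eq_iff transpose_def; linarith?)
  next
    assume "M \<in> ?R"
    then show "M \<in> ?L"
      unfolding matrix_stabilizer stabilizer_equations_def transpose_eq_self_iff trace_def sum_3 zero_eq_mat3
      by (elim CollectE exE conjE)
        (simp add: block_eq_iff transpose_mat3 uminus_mat3; simp add: algebra_simps)
  }
qed

end

theorem proposition3p1:
  fixes \<Omega> :: "'v::real_vector \<Rightarrow> 'v \<Rightarrow> real"
    and e f :: "3 \<Rightarrow> 'v"
    and es fs :: "3 \<Rightarrow> 'v \<Rightarrow> real"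
  assumes "dim (UNIV :: 'v set) = 6"
    and "symplectic_form \<Omega>"
    and "symplectic_basis \<Omega> e f es fs"
  shows
   "(\<forall>\<gamma>::real. \<gamma> \<noteq> 0 \<longrightarrow>
      matrix_wrt e f es fs ` stabilizer \<Omega>
        (\<lambda>u v w. wedge3 (es 1) (es 2) (es 3) u v w + \<gamma> * wedge3 (fs 1) (fs 2) (fs 3) u v w)
      = {block B 0 0 (- transpose B) | B. B \<in> sl3})
  \<and> (\<forall>\<nu>::real. \<nu> \<noteq> 0 \<longrightarrow>
      matrix_wrt e f es fs ` stabilizer \<Omega>
        (\<lambda>u v w. wedge3 (fs 1) (es 2) (es 3) u v w + wedge3 (fs 2) (es 1) (es 3) u v w
               + wedge3 (fs 3) (es 1) (es 2) u v w + \<nu>^2 * wedge3 (fs 1) (fs 2) (fs 3) u v w)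
      = {block
           (mat3 0 \<alpha> \<beta>
                 \<alpha> 0 \<gamma>
                 (-\<beta>) \<gamma> 0)
           (mat3 l1 x1 x2
                 x1 l2 x3
                 x2 x3 l3)
           (mat3 (-(\<nu>^2 * l1)) (\<nu>^2 * x1) (-(\<nu>^2 * x2))
                 (\<nu>^2 * x1) (-(\<nu>^2 * l2)) (\<nu>^2 * x3)
                 (-(\<nu>^2 * x2)) (\<nu>^2 * x3) (-(\<nu>^2 * l3)))
           (mat3 0 (-\<alpha>) \<beta>
                 (-\<alpha>) 0 (-\<gamma>)
                 (-\<beta>) (-\<gamma>) 0)
         | \<alpha> \<beta> \<gamma> l1 l2 l3 x1 x2 x3. l1 - l2 + l3 = 0})
  \<and> (\<forall>\<nu>::real. \<nu> \<noteq> 0 \<longrightarrow>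
      matrix_wrt e f es fs ` stabilizer \<Omega>
        (\<lambda>u v w. wedge3 (fs 1) (es 2) (es 3) u v w - wedge3 (fs 2) (es 1) (es 3) u v w
               + wedge3 (fs 3) (es 1) (es 2) u v w - \<nu>^2 * wedge3 (fs 1) (fs 2) (fs 3) u v w)
      = {block
           (mat3 0 \<alpha> \<beta>
                 (-\<alpha>) 0 \<gamma>
                 (-\<beta>) (-\<gamma>) 0)
           (mat3 l1 x1 x2
                 x1 l2 x3
                 x2 x3 l3)
           (mat3 (-(\<nu>^2 * l1)) (-(\<nu>^2 * x1)) (-(\<nu>^2 * x2))
                 (-(\<nu>^2 * x1)) (-(\<nu>^2 * l2)) (-(\<nu>^2 * x3))
                 (-(\<nu>^2 * x2)) (-(\<nu>^2 * x3)) (-(\<nu>^2 * l3)))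
           (mat3 0 \<alpha> \<beta>
                 (-\<alpha>) 0 \<gamma>
                 (-\<beta>) (-\<gamma>) 0)
         | \<alpha> \<beta> \<gamma> l1 l2 l3 x1 x2 x3. l1 + l2 + l3 = 0})
  \<and> matrix_wrt e f es fs ` stabilizer \<Omega>
        (\<lambda>u v w. wedge3 (fs 1) (es 2) (es 3) u v w + wedge3 (fs 2) (es 1) (es 3) u v w
               + wedge3 (fs 3) (es 1) (es 2) u v w)
      = {block
           (mat3 0 \<alpha> \<beta>
                 \<alpha> 0 \<gamma>
                 (-\<beta>) \<gamma> 0)
           (mat3 l1 x1 x2
                 x1 l2 x3
                 x2 x3 l3)
           0
           (mat3 0 (-\<alpha>) \<beta>
                 (-\<alpha>) 0 (-\<gamma>)
                 (-\<beta>) (-\<gamma>) 0)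
         | \<alpha> \<beta> \<gamma> l1 l2 l3 x1 x2 x3. l1 - l2 + l3 = 0}
  \<and> matrix_wrt e f es fs ` stabilizer \<Omega>
        (\<lambda>u v w. wedge3 (fs 1) (es 2) (es 3) u v w + wedge3 (fs 2) (es 1) (es 3) u v w
               - wedge3 (fs 3) (es 1) (es 2) u v w)
      = {block
           (mat3 0 \<alpha> \<beta>
                 \<alpha> 0 \<gamma>
                 \<beta> (-\<gamma>) 0)
           (mat3 l1 x1 x2
                 x1 l2 x3
                 x2 x3 l3)
           0
           (mat3 0 (-\<alpha>) (-\<beta>)
                 (-\<alpha>) 0 \<gamma>
                 (-\<beta>) (-\<gamma>) 0)
         | \<alpha> \<beta> \<gamma> l1 l2 l3 x1 x2 x3. l1 - l2 - l3 = 0}"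
proof -
  interpret symplectic_coordinates \<Omega> e f es fs
    using assms(3) by unfold_locales
  have forms:
    "(\<lambda>u v w. wedge3 (es 1) (es 2) (es 3) u v w + c * wedge3 (fs 1) (fs 2) (fs 3) u v w)
      = normal_form 1 0 0 0 c"
    "(\<lambda>u v w. wedge3 (fs 1) (es 2) (es 3) u v w + wedge3 (fs 2) (es 1) (es 3) u v w
               + wedge3 (fs 3) (es 1) (es 2) u v w + c * wedge3 (fs 1) (fs 2) (fs 3) u v w)
      = normal_form 0 1 1 1 c"
    "(\<lambda>u v w. wedge3 (fs 1) (es 2) (es 3) u v w - wedge3 (fs 2) (es 1) (es 3) u v w
               + wedge3 (fs 3) (es 1) (es 2) u v w - c * wedge3 (fs 1) (fs 2) (fs 3) u v w)
      = normal_form 0 1 (-1) 1 (- c)"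
    "(\<lambda>u v w. wedge3 (fs 1) (es 2) (es 3) u v w + wedge3 (fs 2) (es 1) (es 3) u v w
               + wedge3 (fs 3) (es 1) (es 2) u v w)
      = normal_form 0 1 1 1 0"
    "(\<lambda>u v w. wedge3 (fs 1) (es 2) (es 3) u v w + wedge3 (fs 2) (es 1) (es 3) u v w
               - wedge3 (fs 3) (es 1) (es 2) u v w)
      = normal_form 0 1 1 (-1) 0" for c
    by (simp_all add: normal_form_def fun_eq_iff)
  \<comment> \<open>Form 4 is form 2 at \<open>r = 0\<close>, where every entry of the lower left
    block becomes 0.\<close>
  have form_4: "matrix_wrt e f es fs ` stabilizer \<Omega> (normal_form 0 1 1 1 0) =
      {block
           (mat3 0 \<alpha> \<beta>
                 \<alpha> 0 \<gamma>
                 (-\<beta>) \<gamma> 0)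
           (mat3 l1 x1 x2
                 x1 l2 x3
                 x2 x3 l3)
           0
           (mat3 0 (-\<alpha>) \<beta>
                 (-\<alpha>) 0 (-\<gamma>)
                 (-\<beta>) (-\<gamma>) 0)
         | \<alpha> \<beta> \<gamma> l1 l2 l3 x1 x2 x3. l1 - l2 + l3 = 0}"
    using stabilizer_form_2[of 0] unfolding zero_eq_mat3 by (simp only: mult_zero_left minus_zero)
  show ?thesis
    unfolding forms
    by (intro conjI allI impI stabilizer_form_1 stabilizer_form_2 stabilizer_form_3 form_4 stabilizer_form_5)
qed

end
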